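(* There exists an absolute constant $c>0$ such that for every integer $k\ge 2$ the following holds: for all primes $p$ sufficiently large (depending on $k$) and all integers $s$ with $0\le s<c\lfloor\sqrt[k]{p}\rfloor$, there exists a set $A$ of $k$ non-zero elements of $\mathbb{Z}_p$ such that $A\cup\{0\}$ is a basis for $\mathbb{Z}_p$ of order $k\lfloor\sqrt[k]{p}\rfloor+s$.
   Context: For a subset $B$ of $\mathbb{Z}_p$ and a positive integer $h$, $hB$ is the set of all sums of exactly $h$ not necessarily distinct elements of $B$. $B$ is a basis for $\mathbb{Z}_p$ of order $h$ if $hB=\mathbb{Z}_p$ and $(h-1)B\neq\mathbb{Z}_p$. *)

theory Defs
  imports Complex_Main "HOL-Computational_Algebra.Primes"
begin

text \<open>Z_p is modelled by the residues {0..<p} with addition mod p.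
  sumset p h B is hB: all sums of exactly h (not necessarily distinct)
  elements of B, reduced mod p. For h = 0 this is {0}.\<close>
definition sumset :: "nat \<Rightarrow> nat \<Rightarrow> nat set \<Rightarrow> nat set" where
  "sumset p h B = {(\<Sum>i<h. f i) mod p | f. \<forall>i<h. f i \<in> B}"

definition is_basis_of_order :: "nat \<Rightarrow> nat set \<Rightarrow> nat \<Rightarrow> bool" where
  "is_basis_of_order p B h \<longleftrightarrow>
     B \<subseteq> {0..<p} \<and> h \<ge> 1 \<and>
     sumset p h B = {0..<p} \<and> sumset p (h - 1) B \<noteq> {0..<p}"

end

theory Submission
  imports Defs
begin

text \<open>
  Let \<open>n\<close> be the integer part of the \<open>k\<close>-th root of \<open>p\<close> and \<open>N = n + 1\<close>. Take
  \<open>a\<^sub>0 = 1\<close>, \<open>a\<^sub>1 = b\<^sub>0\<close>, \<open>a\<^sub>i\<^sub>+\<^sub>1 = b\<^sub>i a\<^sub>i - u\<^sub>i\<close> with \<open>0 \<le> u\<^sub>i < b\<^sub>i\<close>, ending at \<open>a\<^sub>k = p\<close>. Each relation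
  trades \<open>b\<^sub>i\<close> copies of \<open>a\<^sub>i\<close> for \<open>1 + u\<^sub>i \<le> b\<^sub>i\<close> generators, so shortest representations are governed
  by a chip-firing game: a configuration in which no set of firings is legal has minimal length in
  its residue class. The order of \<open>{0, a\<^sub>0, \<dots>, a\<^sub>k\<^sub>-\<^sub>1}\<close> is the maximal size of such a configuration;
  writing \<open>W\<close> for the sum of the \<open>b\<^sub>i - 1\<close> and \<open>U\<close> for the sum of the \<open>u\<^sub>i\<close>, it is \<open>W - 1\<close> if
  \<open>1 \<le> U \<le> b\<^sub>0\<close>, and \<open>W - 2\<close> if \<open>b\<^sub>0 < U\<close> and \<open>1 \<le> u\<^sub>1 \<le> b\<^sub>0\<close>.

  With \<open>b\<^sub>i = N\<close> for \<open>i \<ge> 2\<close> the remainders \<open>u\<^sub>2, u\<^sub>3, \<dots>\<close> do not depend on \<open>b\<^sub>0\<close> and \<open>b\<^sub>1\<close>. Moving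
  \<open>b\<^sub>0\<close> and \<open>b\<^sub>1\<close> apart with fixed sum changes \<open>u\<^sub>1 = b\<^sub>0 b\<^sub>1 - a\<^sub>2\<close> in steps much smaller than \<open>N\<close>.
  If \<open>u\<^sub>2 + u\<^sub>3 + \<dots>\<close> is at most \<open>N / 2\<close> one makes \<open>u\<^sub>1\<close> small and is in the first case; otherwise one makes
  \<open>u\<^sub>1\<close> about \<open>3 N / 4\<close> and is in the second. In both cases \<open>b\<^sub>0 + b\<^sub>1\<close> is free to be prescribed.
\<close>

section \<open>Sumsets as bounded combinations of generators\<close>

text \<open>The element 0 pads a shorter sum to exactly \<open>h\<close> summands, so
  \<open>h\<close> only bounds the number of generators used.\<close>

lemma sumset_insert_0_iff:
  fixes g :: "nat \<Rightarrow> nat"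
  assumes "finite I"
  shows "z \<in> sumset p h (g ` I \<union> {0}) \<longleftrightarrow>
    (\<exists>x::nat \<Rightarrow> nat. sum x I \<le> h \<and> z = (\<Sum>i\<in>I. x i * g i) mod p)"
proof -
  have fwd: "\<exists>x::nat \<Rightarrow> nat. sum x I \<le> h \<and> (\<Sum>i<h. f i) = (\<Sum>i\<in>I. x i * g i)"
    if "\<forall>i<h. f i \<in> g ` I \<union> {0}" for f :: "nat \<Rightarrow> nat"
    using that
  proof (induction h)
    case 0
    then show ?case by (intro exI[of _ "\<lambda>_. 0"]) simp
  next
    case (Suc h)
    then obtain x :: "nat \<Rightarrow> nat"
      where x: "sum x I \<le> h" "(\<Sum>i<h. f i) = (\<Sum>i\<in>I. x i * g i)" by auto
    from Suc.prems have "f h = 0 \<or> (\<exists>j\<in>I. f h = g j)" by auto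
    then show ?case
    proof
      assume "f h = 0"
      with x show ?thesis by (intro exI[of _ x]) simp
    next
      assume "\<exists>j\<in>I. f h = g j"
      then obtain j where j: "j \<in> I" "f h = g j" by blast
      let ?y = "x(j := x j + 1)"
      have "sum ?y I = sum x I + 1"
        using assms j by (simp add: sum.remove[of I j])
      moreover have "(\<Sum>i\<in>I. ?y i * g i) = (\<Sum>i\<in>I. x i * g i) + g j"
        using assms j by (simp add: sum.remove[of I j])
      ultimately show ?thesis using x j by (intro exI[of _ ?y]) simp
    qed
  qed
  have bwd: "\<exists>f::nat \<Rightarrow> nat. (\<forall>i<h. f i \<in> g ` I \<union> {0}) \<and> (\<Sum>i\<in>I. x i * g i) = (\<Sum>i<h. f i)"
    if "sum x I \<le> h" for x :: "nat \<Rightarrow> nat"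
    using that
  proof (induction h arbitrary: x)
    case 0
    then show ?case using assms by auto
  next
    case (Suc h)
    show ?case
    proof (cases "\<exists>j\<in>I. x j > 0")
      case True
      then obtain j where j: "j \<in> I" "x j > 0" by blast
      let ?y = "x(j := x j - 1)"
      have "sum x I = sum ?y I + 1"
        using assms j by (simp add: sum.remove[of I j])
      with Suc.prems have "sum ?y I \<le> h" by simp
      from Suc.IH[OF this] obtain f :: "nat \<Rightarrow> nat" where f: "\<forall>i<h. f i \<in> g ` I \<union> {0}"
        "(\<Sum>i\<in>I. ?y i * g i) = (\<Sum>i<h. f i)" by blast
      have "x j * g j = (x j - 1) * g j + g j"
        using j by (cases "x j") auto
      then have "(\<Sum>i\<in>I. x i * g i) = (\<Sum>i\<in>I. ?y i * g i) + g j"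
        using assms j by (simp add: sum.remove[of I j])
      with f j show ?thesis
        by (intro exI[of _ "f(h := g j)"]) (auto simp: less_Suc_eq)
    next
      case False
      then show ?thesis by (intro exI[of _ "\<lambda>_. 0"]) auto
    qed
  qed
  show ?thesis
  proof
    assume "z \<in> sumset p h (g ` I \<union> {0})"
    then obtain f :: "nat \<Rightarrow> nat" where "z = (\<Sum>i<h. f i) mod p" "\<forall>i<h. f i \<in> g ` I \<union> {0}"
      unfolding sumset_def by blast
    then show "\<exists>x. sum x I \<le> h \<and> z = (\<Sum>i\<in>I. x i * g i) mod p"
      using fwd by metis
  next
    assume "\<exists>x. sum x I \<le> h \<and> z = (\<Sum>i\<in>I. x i * g i) mod p"
    then show "z \<in> sumset p h (g ` I \<union> {0})"
      unfolding sumset_def mem_Collect_eq using bwd by metis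
  qed
qed

section \<open>Chip-firing on a chain of generators\<close>

locale toppling_chain =
  fixes m :: nat and a b u :: "nat \<Rightarrow> int"
  assumes m_pos: "1 \<le> m"
    and a_0: "a 0 = 1"
    and a_Suc: "\<And>i. i \<le> m \<Longrightarrow> a (Suc i) = b i * a i - u i"
    and u_0: "u 0 = 0"
    and u_nonneg: "\<And>i. i \<le> m \<Longrightarrow> 0 \<le> u i"
    and u_less: "\<And>i. i \<le> m \<Longrightarrow> u i < b i"
    and b_ge_3: "\<And>i. i \<le> m \<Longrightarrow> 3 \<le> b i"
begin

definition val :: "(nat \<Rightarrow> int) \<Rightarrow> int" where
  "val x = (\<Sum>i\<le>m. x i * a i)"

text \<open>The chip configuration removed by firing each site \<open>i\<close> exactly \<open>\<sigma> i\<close> times, where one firing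
  of \<open>i\<close> trades \<open>b i\<close> chips at \<open>i\<close> for one chip at \<open>i + 1\<close> and \<open>u i\<close> chips at \<open>0\<close>;
  the chip that site \<open>m\<close> would send to \<open>m + 1\<close> is worth \<open>a (m + 1) = 0\<close> in the cyclic group.\<close>
definition topple :: "(nat \<Rightarrow> int) \<Rightarrow> nat \<Rightarrow> int" where
  "topple \<sigma> i = b i * \<sigma> i - (if i = 0 then (\<Sum>j\<le>m. u j * \<sigma> j) else \<sigma> (i - 1))"

text \<open>This is superstability in the strong sense: a site may fire several times at once, and
  only the final configuration is tested for non-negativity.\<close>

definition reduced :: "(nat \<Rightarrow> int) \<Rightarrow> bool" where
  "reduced x \<longleftrightarrow> (\<forall>i\<le>m. 0 \<le> x i) \<and>
     (\<forall>\<sigma>. (\<forall>i\<le>m. 0 \<le> \<sigma> i) \<longrightarrow> (\<forall>i\<le>m. topple \<sigma> i \<le> x i) \<longrightarrow> (\<forall>i\<le>m. \<sigma> i = 0))"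

lemma sum_split_0: "(\<Sum>i\<le>m. f i) = f 0 + (\<Sum>i<m. f (Suc i))" for f :: "nat \<Rightarrow> int"
  by (rule sum.atMost_shift)

lemma sum_split_last: "(\<Sum>i\<le>m. f i) = (\<Sum>i<m. f i) + f m" for f :: "nat \<Rightarrow> int"
  by (metis add.commute lessThan_Suc_atMost sum.lessThan_Suc)

text \<open>Transposing the firing matrix yields the effect of a firing on the value, the chip count
  and the potential, according to the weights \<open>w\<close>.\<close>

lemma sum_topple_mult:
  "(\<Sum>i\<le>m. topple \<sigma> i * w i)
     = (\<Sum>i\<le>m. \<sigma> i * (b i * w i - u i * w 0)) - (\<Sum>i<m. \<sigma> i * w (Suc i))"
proof -
  have "(\<Sum>i\<le>m. topple \<sigma> i * w i) = (\<Sum>i\<le>m. b i * \<sigma> i * w i)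
      - (\<Sum>i\<le>m. (if i = 0 then (\<Sum>j\<le>m. u j * \<sigma> j) else \<sigma> (i - 1)) * w i)"
    by (simp add: topple_def left_diff_distrib sum_subtractf)
  also have "(\<Sum>i\<le>m. (if i = 0 then (\<Sum>j\<le>m. u j * \<sigma> j) else \<sigma> (i - 1)) * w i)
      = (\<Sum>j\<le>m. u j * \<sigma> j) * w 0 + (\<Sum>i<m. \<sigma> i * w (Suc i))"
    by (simp add: sum_split_0)
  finally show ?thesis
    by (simp add: right_diff_distrib sum_subtractf sum_distrib_left mult_ac)
qed

lemma val_topple: "val (topple \<sigma>) = \<sigma> m * a (Suc m)"
proof -
  have "(\<Sum>i\<le>m. \<sigma> i * (b i * a i - u i * a 0)) = (\<Sum>i\<le>m. \<sigma> i * a (Suc i))"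
    by (rule sum.cong) (auto simp: a_0 a_Suc)
  then show ?thesis
    unfolding val_def sum_topple_mult by (simp add: sum_split_last)
qed

lemma val_diff: "val (\<lambda>i. x i - y i) = val x - val y"
  by (simp add: val_def left_diff_distrib sum_subtractf)

text \<open>Firings span the whole relation lattice. \<open>val_topple\<close> prescribes the
  coefficient at \<open>m\<close>, the equations at sites \<open>m\<close> down to 1 determine the
  others, and the equation at 0 follows by comparing values, since \<open>a 0 = 1\<close>.\<close>

lemma relation_is_topple:
  assumes "a (Suc m) dvd val d"
  shows "\<exists>\<sigma>. \<forall>i\<le>m. d i = topple \<sigma> i"
proof -
  obtain q where q: "val d = q * a (Suc m)"
    using assms by (auto simp: dvd_def mult.commute)
  define \<tau> where "\<tau> = rec_nat q (\<lambda>j t. b (m - j) * t - d (m - j))"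
  define \<sigma> where "\<sigma> i = \<tau> (m - i)" for i
  have top: "\<sigma> m = q" by (simp add: \<sigma>_def \<tau>_def)
  have step: "topple \<sigma> i = d i" if "i \<le> m" "i \<noteq> 0" for i
  proof -
    have "m - (i - 1) = Suc (m - i)" "m - (m - i) = i" using that by auto
    then have "\<sigma> (i - 1) = b i * \<sigma> i - d i" by (simp add: \<sigma>_def \<tau>_def)
    then show ?thesis using that by (simp add: topple_def)
  qed
  have "val (topple \<sigma>) = val d" by (simp add: val_topple top q)
  moreover have "(\<Sum>i<m. topple \<sigma> (Suc i) * a (Suc i)) = (\<Sum>i<m. d (Suc i) * a (Suc i))"
    by (rule sum.cong) (auto simp: step)
  ultimately have "topple \<sigma> 0 = d 0"
    by (simp add: val_def sum_split_0 a_0)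
  with step show ?thesis by (metis)
qed

text \<open>The difference \<open>x - y\<close> is a firing whose coefficients are forced to be
  nonpositive. So \<open>x\<close> arises from \<open>y\<close> by firings, none of which adds chips
  because \<open>u i < b i\<close>.\<close>

lemma reduced_minimal:
  assumes red: "reduced x" and y: "\<forall>i\<le>m. 0 \<le> y i" and eq: "a (Suc m) dvd val x - val y"
  shows "(\<Sum>i\<le>m. x i) \<le> (\<Sum>i\<le>m. y i)"
proof -
  have "a (Suc m) dvd val (\<lambda>i. x i - y i)" using eq by (simp add: val_diff)
  then obtain \<sigma> where \<sigma>: "\<forall>i\<le>m. x i - y i = topple \<sigma> i"
    using relation_is_topple by blast
  \<comment> \<open>The positive part of \<open>\<sigma>\<close> is itself a legal firing, because off-diagonal transfers only add chips.\<close>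
  define \<tau> where "\<tau> i = max (\<sigma> i) 0" for i
  have "topple \<tau> i \<le> x i" if i: "i \<le> m" for i
  proof (cases "\<sigma> i > 0")
    case True
    have "(\<Sum>j\<le>m. u j * \<sigma> j) \<le> (\<Sum>j\<le>m. u j * \<tau> j)"
      by (rule sum_mono) (auto simp: \<tau>_def u_nonneg intro!: mult_left_mono)
    then have "topple \<tau> i \<le> topple \<sigma> i"
      using True by (auto simp: topple_def \<tau>_def)
    also have "\<dots> = x i - y i" using \<sigma> i by simp
    also have "\<dots> \<le> x i" using y i by simp
    finally show ?thesis .
  next
    case False
    have "0 \<le> (\<Sum>j\<le>m. u j * \<tau> j)"
      by (rule sum_nonneg) (auto simp: \<tau>_def u_nonneg)
    then have "topple \<tau> i \<le> 0" using False by (auto simp: topple_def \<tau>_def)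
    also have "0 \<le> x i" using red i by (simp add: reduced_def)
    finally show ?thesis .
  qed
  moreover have "\<forall>i\<le>m. 0 \<le> \<tau> i" by (simp add: \<tau>_def)
  ultimately have "\<forall>i\<le>m. \<tau> i = 0" using red by (simp add: reduced_def)
  then have neg: "\<sigma> i \<le> 0" if "i \<le> m" for i using that by (auto simp: \<tau>_def max_def split: if_splits)
  have "(\<Sum>i\<le>m. x i) - (\<Sum>i\<le>m. y i) = (\<Sum>i\<le>m. topple \<sigma> i * 1)"
    using \<sigma> by (simp flip: sum_subtractf)
  also have "\<dots> = (\<Sum>i\<le>m. \<sigma> i * (b i - u i)) - (\<Sum>i<m. \<sigma> i)"
    unfolding sum_topple_mult[of \<sigma> "\<lambda>_. 1"] by simp
  also have "\<dots> = (\<Sum>i\<le>m. \<sigma> i * (b i - u i - 1)) + \<sigma> m"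
    using sum_split_last[of \<sigma>] by (simp add: right_diff_distrib sum_subtractf)
  also have "\<dots> \<le> 0"
  proof -
    have "(\<Sum>i\<le>m. \<sigma> i * (b i - u i - 1)) \<le> 0"
      using neg u_less by (intro sum_nonpos mult_nonpos_nonneg) force+
    then show ?thesis using neg[of m] by simp
  qed
  finally show ?thesis by simp
qed

text \<open>A chip at site \<open>0\<close> weighs half as much as any other, which makes the potential
  strictly decreasing even when a firing preserves the number of chips (\<open>u i = b i - 1\<close>).\<close>
lemma exists_reduced:
  assumes "\<forall>i\<le>m. 0 \<le> x i"
  shows "\<exists>y. reduced y \<and> a (Suc m) dvd val y - val x"
proof -
  define w :: "nat \<Rightarrow> int" where "w i = (if i = 0 then 1 else 2)" for i
  define \<Phi> where "\<Phi> y = (\<Sum>i\<le>m. y i * w i)" for y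
  define R where "R y \<longleftrightarrow> (\<forall>i\<le>m. 0 \<le> y i) \<and> a (Suc m) dvd val y - val x" for y
  have "R x" using assms by (simp add: R_def)
  then obtain y where y: "R y" and least: "\<And>y'. R y' \<Longrightarrow> nat (\<Phi> y) \<le> nat (\<Phi> y')"
    using ex_has_least_nat[of R x "\<lambda>y. nat (\<Phi> y)"] by blast
  have "\<forall>i\<le>m. \<sigma> i = 0"
    if nn: "\<forall>i\<le>m. 0 \<le> \<sigma> i" and le: "\<forall>i\<le>m. topple \<sigma> i \<le> y i" for \<sigma>
  proof -
    define y' where "y' i = y i - topple \<sigma> i" for i
    have "val y' = val y - \<sigma> m * a (Suc m)"
      unfolding y'_def val_diff val_topple ..
    then have "val y' - val x = val y - val x - \<sigma> m * a (Suc m)" by simp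
    moreover have "a (Suc m) dvd val y - val x - \<sigma> m * a (Suc m)"
      using y dvd_triv_right unfolding R_def by (blast intro: dvd_diff)
    ultimately have "a (Suc m) dvd val y' - val x" by metis
    then have "R y'"
      using le by (simp add: R_def y'_def)
    then have "nat (\<Phi> y) \<le> nat (\<Phi> y')" by (rule least)
    moreover have "0 \<le> \<Phi> y'"
      using \<open>R y'\<close> unfolding \<Phi>_def R_def w_def by (auto intro!: sum_nonneg)
    ultimately have "\<Phi> y \<le> \<Phi> y'" by linarith
    then have "\<Phi> (topple \<sigma>) \<le> 0"
      by (simp add: \<Phi>_def y'_def left_diff_distrib sum_subtractf)
    moreover have "(\<Sum>i\<le>m. \<sigma> i) \<le> \<Phi> (topple \<sigma>)"
    proof -
      \<comment> \<open>At site 0 the factor is \<open>b 0\<close>, as \<open>u 0 = 0\<close>;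
        elsewhere it is \<open>2 * b i - u i > b i\<close>. The excess over the weight 2 passed on
        makes every firing cost at least 1.\<close>
      have "\<sigma> i * 3 \<le> \<sigma> i * (b i * w i - u i * w 0)" if "i \<le> m" for i
        using nn that u_less[OF that] b_ge_3[OF that] u_0
        by (intro mult_left_mono) (auto simp: w_def)
      then have "(\<Sum>i\<le>m. \<sigma> i * 3) \<le> (\<Sum>i\<le>m. \<sigma> i * (b i * w i - u i * w 0))"
        by (intro sum_mono) auto
      moreover have "(\<Sum>i<m. \<sigma> i * w (Suc i)) = 2 * (\<Sum>i<m. \<sigma> i)"
        by (simp add: w_def sum_distrib_left mult.commute)
      ultimately show ?thesis
        using nn[rule_format, of m] sum_split_last[of \<sigma>]
        unfolding \<Phi>_def sum_topple_mult by (simp flip: sum_distrib_right)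
    qed
    ultimately have "(\<Sum>i\<le>m. \<sigma> i) \<le> 0" by simp
    moreover have "0 \<le> (\<Sum>i\<le>m. \<sigma> i)" using nn by (intro sum_nonneg) auto
    ultimately have "(\<Sum>i\<le>m. \<sigma> i) = 0" by simp
    then show ?thesis using nn by (subst (asm) sum_nonneg_eq_0_iff) auto
  qed
  then show ?thesis using y unfolding reduced_def R_def by blast
qed

section \<open>Upper bounds for reduced configurations\<close>

lemma not_reducedI:
  assumes "\<forall>i\<le>m. 0 \<le> \<sigma> i" "\<forall>i\<le>m. topple \<sigma> i \<le> x i" "i \<le> m" "\<sigma> i \<noteq> 0"
  shows "\<not> reduced x"
  using assms unfolding reduced_def by blast

lemma reduced_less:
  assumes red: "reduced x" and i: "i \<le> m"
  shows "x i < b i"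
proof (rule ccontr)
  assume "\<not> x i < b i"
  then have ge: "b i \<le> x i" by simp
  define \<sigma> :: "nat \<Rightarrow> int" where "\<sigma> j = (if j = i then 1 else 0)" for j
  have xs: "0 \<le> x j" if "j \<le> m" for j using red that by (simp add: reduced_def)
  have "(\<Sum>j\<le>m. u j * \<sigma> j) = u i"
    using i by (simp add: \<sigma>_def if_distrib cong: if_cong)
  then have "topple \<sigma> j \<le> x j" if "j \<le> m" for j
    using ge xs[OF that] u_nonneg[OF i] by (auto simp: topple_def \<sigma>_def)
  then have "\<not> reduced x"
    using i by (intro not_reducedI[of \<sigma> _ i]) (auto simp: \<sigma>_def)
  with red show False by blast
qed

text \<open>By \<open>reduced_less\<close>, a larger configuration has \<open>b i - 1\<close> chips
  at every site; firing all sites once is then legal, since site 0 gets a chip back.\<close>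

lemma reduced_sum_le_1:
  assumes red: "reduced x" and U: "1 \<le> (\<Sum>i\<le>m. u i)"
  shows "(\<Sum>i\<le>m. x i) \<le> (\<Sum>i\<le>m. b i - 1) - 1"
proof (rule ccontr)
  assume "\<not> ?thesis"
  then have "(\<Sum>i\<le>m. b i - 1 - x i) \<le> 0" by (simp add: sum_subtractf)
  moreover have nn: "0 \<le> b i - 1 - x i" if "i \<le> m" for i
    using reduced_less[OF red that] by simp
  ultimately have "(\<Sum>i\<le>m. b i - 1 - x i) = 0"
    by (intro antisym sum_nonneg) auto
  then have "\<forall>i\<le>m. b i - 1 - x i = 0"
    using nn by (subst (asm) sum_nonneg_eq_0_iff) auto
  then have "\<not> reduced x"
    using U by (intro not_reducedI[of "\<lambda>_. 1" _ 0]) (auto simp: topple_def)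
  with red show False by blast
qed

lemma reduced_sum_le_2:
  assumes red: "reduced x" and U: "b 0 < (\<Sum>i\<le>m. u i)" and u1: "1 \<le> u 1"
  shows "(\<Sum>i\<le>m. x i) \<le> (\<Sum>i\<le>m. b i - 1) - 2"
proof (rule ccontr)
  assume "\<not> ?thesis"
  then have D: "(\<Sum>i\<le>m. b i - 1 - x i) \<le> 1" by (simp add: sum_subtractf)
  have nn: "0 \<le> b i - 1 - x i" if "i \<le> m" for i
    using reduced_less[OF red that] by simp
  obtain j where j: "j \<le> m" "b j - 2 \<le> x j" "\<And>i. i \<le> m \<Longrightarrow> i \<noteq> j \<Longrightarrow> b i - 1 \<le> x i"
  proof (cases "\<exists>j\<le>m. 1 \<le> b j - 1 - x j")
    case True
    then obtain j where j: "j \<le> m" "1 \<le> b j - 1 - x j" by blast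
    have "(\<Sum>i\<le>m. b i - 1 - x i) = (b j - 1 - x j) + (\<Sum>i\<in>{..m} - {j}. b i - 1 - x i)"
      using j by (simp add: sum.remove)
    moreover have nn': "0 \<le> (\<Sum>i\<in>{..m} - {j}. b i - 1 - x i)"
      using nn by (intro sum_nonneg) auto
    ultimately have "(\<Sum>i\<in>{..m} - {j}. b i - 1 - x i) = 0" "b j - 1 - x j \<le> 1"
      using D j by linarith+
    moreover from this(1) have "\<forall>i\<in>{..m} - {j}. b i - 1 - x i = 0"
      using nn by (subst (asm) sum_nonneg_eq_0_iff) auto
    ultimately show ?thesis using j by (intro that[of j]) auto
  next
    case False
    then show ?thesis by (intro that[of 0]) force+
  qed
  have xs: "0 \<le> x i" if "i \<le> m" for i using red that by (simp add: reduced_def)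
  consider "j = 0" | "j = 1" | "2 \<le> j" by linarith
  then have "\<not> reduced x"
  proof cases
    case 1
    have "topple (\<lambda>_. 1) i \<le> x i" if "i \<le> m" for i
      using j(2) j(3)[of i] 1 that U b_ge_3[of 0] by (auto simp: topple_def)
    then show ?thesis by (intro not_reducedI[of "\<lambda>_. 1" _ 0]) auto
  next
    case 2
    \<comment> \<open>The second firing of site 0 supplies the chip missing at site 1; site 0
      affords it because more than \<open>b 0\<close> chips return.\<close>
    define \<sigma> :: "nat \<Rightarrow> int" where "\<sigma> i = (if i = 0 then 2 else 1)" for i
    have "(\<Sum>i\<le>m. u i * \<sigma> i) = (\<Sum>i\<le>m. u i)"
      by (rule sum.cong) (auto simp: \<sigma>_def u_0)
    then have "topple \<sigma> i \<le> x i" if "i \<le> m" for i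
      using j(2) j(3)[of i] 2 that U
      by (cases "i = 0"; cases "i = 1") (auto simp: topple_def \<sigma>_def)
    then show ?thesis by (intro not_reducedI[of \<sigma> _ 0]) (auto simp: \<sigma>_def)
  next
    case 3
    \<comment> \<open>Firing stops before \<open>j\<close>, so the deficit there is harmless;
      \<open>u 1\<close> still returns a chip to site 0.\<close>
    define \<sigma> :: "nat \<Rightarrow> int" where "\<sigma> i = (if i < j then 1 else 0)" for i
    have "u 1 * \<sigma> 1 \<le> (\<Sum>i\<le>m. u i * \<sigma> i)"
      using m_pos by (intro member_le_sum) (auto simp: \<sigma>_def u_nonneg)
    then have "1 \<le> (\<Sum>i\<le>m. u i * \<sigma> i)" using u1 3 by (simp add: \<sigma>_def)
    moreover have "b 0 - 1 \<le> x 0" using j(3)[of 0] 3 by simp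
    ultimately have "topple \<sigma> 0 \<le> x 0" using 3 by (simp add: topple_def \<sigma>_def)
    moreover have "topple \<sigma> i \<le> x i" if "i \<le> m" "i \<noteq> 0" for i
      using j(3)[of i] that xs[of i] by (auto simp: topple_def \<sigma>_def)
    ultimately have "\<forall>i\<le>m. topple \<sigma> i \<le> x i" by metis
    then show ?thesis using 3 by (intro not_reducedI[of \<sigma> _ 0]) (auto simp: \<sigma>_def)
  qed
  with red show False by blast
qed

section \<open>Maximal reduced configurations\<close>

text \<open>A site lacking \<open>c\<close> chips from \<open>b i - 1\<close> can fire only when
  supplied by its predecessor, which must then fire at least \<open>c\<close> times more.\<close>

lemma firing_step:
  assumes "i \<noteq> 0" "i \<le> m" "0 \<le> \<sigma> (i - 1)" "0 < \<sigma> i" "topple \<sigma> i \<le> b i - 1 - c"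
  shows "b i * (\<sigma> i - 1) + 1 + c \<le> \<sigma> (i - 1)" "\<sigma> i + c \<le> \<sigma> (i - 1)"
proof -
  show 1: "b i * (\<sigma> i - 1) + 1 + c \<le> \<sigma> (i - 1)"
    using assms by (simp add: topple_def algebra_simps)
  have "1 * (\<sigma> i - 1) \<le> b i * (\<sigma> i - 1)"
    using assms b_ge_3[of i] by (intro mult_right_mono) auto
  with 1 show "\<sigma> i + c \<le> \<sigma> (i - 1)" by simp
qed

lemma firing_antimono:
  assumes nn: "\<forall>i\<le>m. 0 \<le> \<sigma> i" and le: "\<forall>i\<le>m. topple \<sigma> i \<le> b i - 1"
    and "j \<le> i" "i \<le> m"
  shows "\<sigma> i \<le> \<sigma> j"
  using \<open>j \<le> i\<close> \<open>i \<le> m\<close>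
proof (induction i rule: dec_induct)
  case (step i)
  have "\<sigma> (Suc i) \<le> \<sigma> i"
  proof (cases "\<sigma> (Suc i) = 0")
    case False
    then show ?thesis
      using firing_step(2)[of "Suc i" \<sigma> 0] nn le step.prems by fastforce
  qed (use nn step.prems in auto)
  with step show ?case by auto
qed simp

text \<open>If site 1 fires, its missing chip forces \<open>\<sigma> 0 > \<sigma> 1\<close>, while
  the at most \<open>b 0 * \<sigma> 1\<close> chips returned to site 0 only allow
  \<open>\<sigma> 0 \<le> \<sigma> 1\<close>.\<close>

lemma reduced_witness_1:
  assumes U: "(\<Sum>i\<le>m. u i) \<le> b 0"
  defines "x \<equiv> \<lambda>i. if i = 1 then b i - 2 else b i - 1"
  shows "reduced x" "(\<Sum>i\<le>m. x i) = (\<Sum>i\<le>m. b i - 1) - 1"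
proof -
  have "\<forall>i\<le>m. \<sigma> i = 0"
    if nn: "\<forall>i\<le>m. 0 \<le> \<sigma> i" and le: "\<forall>i\<le>m. topple \<sigma> i \<le> x i" for \<sigma>
  proof -
    have le': "\<forall>i\<le>m. topple \<sigma> i \<le> b i - 1" using le by (fastforce simp: x_def split: if_splits)
    note mono = firing_antimono[OF nn le']
    have "(\<Sum>i\<le>m. u i * \<sigma> i) \<le> (\<Sum>i\<le>m. u i * \<sigma> 1)"
      using mono[of 1] u_0 u_nonneg
      by (intro sum_mono) (metis One_nat_def Suc_leI atMost_iff mult_left_mono mult_zero_left neq0_conv order_refl)
    also have "\<dots> \<le> b 0 * \<sigma> 1"
      unfolding sum_distrib_right[symmetric] using U nn m_pos by (intro mult_right_mono) auto
    finally have "b 0 * \<sigma> 0 - b 0 * \<sigma> 1 \<le> b 0 - 1"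
      using le' by (force simp: topple_def)
    then have "b 0 * (\<sigma> 0 - \<sigma> 1) < b 0 * 1" by (simp add: right_diff_distrib)
    then have "\<sigma> 0 - \<sigma> 1 < 1" using b_ge_3[of 0] by (simp add: mult_less_cancel_left)
    moreover have "\<sigma> 1 + 1 \<le> \<sigma> 0" if "\<sigma> 1 > 0"
      using firing_step(2)[of 1 \<sigma> 1] that le nn m_pos by (force simp: x_def)
    moreover have "\<sigma> 1 \<ge> 0" using nn m_pos by simp
    ultimately have "\<sigma> 0 \<le> 0" by linarith
    then show ?thesis using mono[of 0] nn by force
  qed
  moreover have "\<forall>i\<le>m. 0 \<le> x i" using b_ge_3 by (force simp: x_def)
  ultimately show "reduced x" by (simp add: reduced_def)
  have "(\<Sum>i\<le>m. x i) = (\<Sum>i\<le>m. (b i - 1) - (if i = 1 then 1 else 0))"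
    by (rule sum.cong) (auto simp: x_def)
  also have "\<dots> = (\<Sum>i\<le>m. b i - 1) - (\<Sum>i\<le>m. if i = 1 then 1 else 0)"
    by (rule sum_subtractf)
  also have "(\<Sum>i\<le>m. if i = 1 then 1 else (0::int)) = 1"
    using m_pos by simp
  finally show "(\<Sum>i\<le>m. x i) = (\<Sum>i\<le>m. b i - 1) - 1" .
qed

text \<open>If site 2 fires, then \<open>\<sigma> 1 \<ge> 2\<close> and site 0 fires more than
  \<open>b 1 * (\<sigma> 1 - 1)\<close> times, for which too few chips return. Otherwise only
  \<open>u 1\<close> returns chips, and the argument with one missing chip applies.\<close>

lemma reduced_witness_2:
  assumes m2: "2 \<le> m" and U: "2 * (\<Sum>i\<le>m. u i) \<le> b 0 * b 1" and u1: "u 1 \<le> b 0"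
  defines "x \<equiv> \<lambda>i. if i = 1 \<or> i = 2 then b i - 2 else b i - 1"
  shows "reduced x" "(\<Sum>i\<le>m. x i) = (\<Sum>i\<le>m. b i - 1) - 2"
proof -
  have "\<forall>i\<le>m. \<sigma> i = 0"
    if nn: "\<forall>i\<le>m. 0 \<le> \<sigma> i" and le: "\<forall>i\<le>m. topple \<sigma> i \<le> x i" for \<sigma>
  proof -
    have le': "\<forall>i\<le>m. topple \<sigma> i \<le> b i - 1" using le by (fastforce simp: x_def split: if_splits)
    note mono = firing_antimono[OF nn le']
    have s: "0 \<le> \<sigma> 0" "0 \<le> \<sigma> 1" "0 \<le> \<sigma> 2" using nn m2 by auto
    have t0: "b 0 * (\<sigma> 0 - 1) < (\<Sum>i\<le>m. u i * \<sigma> i)"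
      using le' by (force simp: topple_def right_diff_distrib)
    have "\<sigma> 2 = 0"
    proof (rule ccontr)
      assume "\<sigma> 2 \<noteq> 0"
      then have "\<sigma> 2 > 0" using s by simp
      then have "\<sigma> 2 + 1 \<le> \<sigma> 1"
        using firing_step(2)[of 2 \<sigma> 1] le s m2 by (force simp: x_def)
      then have s1: "2 \<le> \<sigma> 1" using \<open>\<sigma> 2 > 0\<close> by simp
      then have s0: "b 1 * (\<sigma> 1 - 1) + 2 \<le> \<sigma> 0"
        using firing_step(1)[of 1 \<sigma> 1] le[rule_format, of 1] s m2 by (simp add: x_def)
      have "(\<Sum>i\<le>m. u i * \<sigma> i) \<le> (\<Sum>i\<le>m. u i * \<sigma> 1)"
        using mono[of 1] u_0 u_nonneg
        by (intro sum_mono) (metis One_nat_def Suc_leI atMost_iff mult_left_mono mult_zero_left neq0_conv order_refl)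
      then have "2 * (\<Sum>i\<le>m. u i * \<sigma> i) \<le> (2 * (\<Sum>i\<le>m. u i)) * \<sigma> 1"
        by (simp add: sum_distrib_right)
      also have "\<dots> \<le> (b 0 * b 1) * \<sigma> 1"
        using U s by (intro mult_right_mono) auto
      \<comment> \<open>The factor 2 in the bound on the remainders pays for this replacement of
        \<open>\<sigma> 1\<close>.\<close>
      also have "\<dots> \<le> (b 0 * b 1) * (2 * (\<sigma> 1 - 1))"
        using s1 b_ge_3[of 0] b_ge_3[of 1] m2 by (intro mult_left_mono) auto
      also have "\<dots> = 2 * (b 0 * (b 1 * (\<sigma> 1 - 1)))" by (simp add: mult_ac)
      also have "\<dots> \<le> 2 * (b 0 * (\<sigma> 0 - 1))"
        using s0 b_ge_3[of 0] by (intro mult_left_mono) auto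
      finally show False using t0 by simp
    qed
    then have zero: "\<sigma> i = 0" if "2 \<le> i" "i \<le> m" for i
      using mono[of 2 i] nn that by force
    have "(\<Sum>i\<le>m. u i * \<sigma> i) = (\<Sum>i\<le>m. if i = 1 then u 1 * \<sigma> 1 else 0)"
    proof (rule sum.cong)
      fix i assume "i \<in> {..m}"
      then show "u i * \<sigma> i = (if i = 1 then u 1 * \<sigma> 1 else 0)"
        using zero[of i] u_0 by (cases "i = 0"; cases "i = 1") auto
    qed simp
    also have "\<dots> = u 1 * \<sigma> 1" using m2 by simp
    also have "\<dots> \<le> b 0 * \<sigma> 1" using u1 s by (intro mult_right_mono) auto
    finally have "b 0 * (\<sigma> 0 - 1) < b 0 * \<sigma> 1" using t0 by simp
    then have "\<sigma> 0 - 1 < \<sigma> 1" using b_ge_3[of 0] by (simp add: mult_less_cancel_left)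
    moreover have "\<sigma> 1 + 1 \<le> \<sigma> 0" if "\<sigma> 1 > 0"
      using firing_step(2)[of 1 \<sigma> 1] that le nn m_pos by (force simp: x_def)
    ultimately have "\<sigma> 0 \<le> 0" using s by linarith
    then show ?thesis using mono[of 0] nn by force
  qed
  moreover have "\<forall>i\<le>m. 0 \<le> x i" using b_ge_3 by (force simp: x_def)
  ultimately show "reduced x" by (simp add: reduced_def)
  have "(\<Sum>i\<le>m. x i) = (\<Sum>i\<le>m. (b i - 1) - ((if i = 1 then 1 else 0) + (if i = 2 then 1 else 0)))"
    by (rule sum.cong) (auto simp: x_def)
  also have "\<dots> = (\<Sum>i\<le>m. b i - 1)
      - ((\<Sum>i\<le>m. if i = 1 then 1 else 0) + (\<Sum>i\<le>m. if i = 2 then 1 else 0))"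
    by (simp only: sum_subtractf sum.distrib)
  also have "(\<Sum>i\<le>m. if i = 1 then 1 else (0::int)) = 1"
    using m_pos by simp
  also have "(\<Sum>i\<le>m. if i = 2 then 1 else (0::int)) = 1"
    using m2 by simp
  finally show "(\<Sum>i\<le>m. x i) = (\<Sum>i\<le>m. b i - 1) - 2" by simp
qed

section \<open>From reduced configurations to the order of the basis\<close>

lemma a_less_Suc: "i \<le> m \<Longrightarrow> 1 \<le> a i \<and> a i < a (Suc i)"
proof (induction i)
  case 0
  then show ?case using a_Suc[of 0] a_0 u_0 b_ge_3[of 0] by simp
next
  case (Suc i)
  then have a2: "2 \<le> a (Suc i)" by simp
  have "a (Suc (Suc i)) > b (Suc i) * (a (Suc i) - 1)"
    using a_Suc[of "Suc i"] u_less[of "Suc i"] Suc.prems by (simp add: right_diff_distrib)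
  moreover have "3 * (a (Suc i) - 1) \<le> b (Suc i) * (a (Suc i) - 1)"
    using b_ge_3[of "Suc i"] a2 Suc.prems by (intro mult_right_mono) auto
  ultimately show ?case using a2 by simp
qed

lemma a_less: "i < j \<Longrightarrow> j \<le> Suc m \<Longrightarrow> a i < a j"
proof (induction j)
  case (Suc j)
  then show ?case using a_less_Suc[of j] by (cases "i = j") force+
qed simp

lemma a_ge_1: "1 \<le> a i" if "i \<le> Suc m"
proof (cases i)
  case 0
  then show ?thesis by (simp add: a_0)
next
  case (Suc j)
  with that a_less_Suc[of j] show ?thesis by simp
qed

text \<open>Every residue has a reduced representative, hence one with at most \<open>V\<close>
  chips, while the class of \<open>x\<close> has none with fewer.\<close>

lemma basis_of_order:
  assumes x: "reduced x" "(\<Sum>i\<le>m. x i) = V" and V: "1 \<le> V"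
    and max: "\<And>y. reduced y \<Longrightarrow> (\<Sum>i\<le>m. y i) \<le> V"
  shows "(\<lambda>i. nat (a i)) ` {..m} \<subseteq> {1..<nat (a (Suc m))}"
    "card ((\<lambda>i. nat (a i)) ` {..m}) = Suc m"
    "is_basis_of_order (nat (a (Suc m))) ((\<lambda>i. nat (a i)) ` {..m} \<union> {0}) (nat V)"
proof -
  let ?g = "\<lambda>i. nat (a i)" and ?p = "nat (a (Suc m))"
  show sub: "?g ` {..m} \<subseteq> {1..<?p}"
  proof (intro image_subsetI)
    fix i assume "i \<in> {..m}"
    then have "1 \<le> a i" "a i < a (Suc m)" using a_ge_1[of i] a_less[of i "Suc m"] by auto
    then show "?g i \<in> {1..<?p}" by auto
  qed
  have "inj_on ?g {..m}"
  proof (rule linorder_inj_onI)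
    fix i j assume "i < j" "i \<in> {..m}" "j \<in> {..m}"
    then show "?g i \<noteq> ?g j" using a_less[of i j] a_ge_1[of i] by auto
  qed auto
  then show "card (?g ` {..m}) = Suc m" by (simp add: card_image)
  have p: "0 < a (Suc m)" using a_ge_1[of "Suc m"] by simp
  have mem: "z \<in> sumset ?p h (?g ` {..m} \<union> {0}) \<longleftrightarrow>
      (\<exists>y. (\<forall>i\<le>m. 0 \<le> y i) \<and> (\<Sum>i\<le>m. y i) \<le> int h \<and> int z = val y mod a (Suc m))" for z h
  proof -
    have val_nat: "int ((\<Sum>i\<le>m. y i * ?g i) mod ?p) = val (\<lambda>i. int (y i)) mod a (Suc m)" for y
    proof -
      have "(\<Sum>i\<le>m. int (y i) * int (?g i)) = (\<Sum>i\<le>m. int (y i) * a i)"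
      proof (rule sum.cong)
        fix i assume "i \<in> {..m}"
        then have "0 \<le> a i" using a_ge_1[of i] by simp
        then show "int (y i) * int (?g i) = int (y i) * a i" by simp
      qed simp
      then show ?thesis using p by (simp add: zmod_int val_def)
    qed
    show ?thesis unfolding sumset_insert_0_iff[OF finite_atMost]
    proof
      assume "\<exists>y. sum y {..m} \<le> h \<and> z = (\<Sum>i\<le>m. y i * ?g i) mod ?p"
      then obtain y :: "nat \<Rightarrow> nat" where y: "sum y {..m} \<le> h" "z = (\<Sum>i\<le>m. y i * ?g i) mod ?p"
        by blast
      have "(\<Sum>i\<le>m. int (y i)) \<le> int h" using y(1) by (simp flip: of_nat_sum)
      then show "\<exists>y. (\<forall>i\<le>m. 0 \<le> y i) \<and> (\<Sum>i\<le>m. y i) \<le> int h \<and> int z = val y mod a (Suc m)"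
        using val_nat[of y] y(2) by (intro exI[of _ "\<lambda>i. int (y i)"]) simp
    next
      assume "\<exists>y. (\<forall>i\<le>m. 0 \<le> y i) \<and> (\<Sum>i\<le>m. y i) \<le> int h \<and> int z = val y mod a (Suc m)"
      then obtain y where y: "\<forall>i\<le>m. 0 \<le> y i" "(\<Sum>i\<le>m. y i) \<le> int h" "int z = val y mod a (Suc m)"
        by blast
      have "(\<Sum>i\<le>m. int (nat (y i))) = (\<Sum>i\<le>m. y i)"
        using y(1) by (intro sum.cong) auto
      then have "int (\<Sum>i\<le>m. nat (y i)) \<le> int h" using y(2) by simp
      then have "(\<Sum>i\<le>m. nat (y i)) \<le> h" by (simp only: of_nat_le_iff)
      moreover have "val (\<lambda>i. int (nat (y i))) = val y"
        unfolding val_def using y(1) by (intro sum.cong) auto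
      then have "int ((\<Sum>i\<le>m. nat (y i) * ?g i) mod ?p) = int z"
        using val_nat[of "\<lambda>i. nat (y i)"] y(3) by simp
      ultimately show "\<exists>y. sum y {..m} \<le> h \<and> z = (\<Sum>i\<le>m. y i * ?g i) mod ?p"
        by (metis of_nat_eq_iff)
    qed
  qed
  have "sumset ?p (nat V) (?g ` {..m} \<union> {0}) = {0..<?p}"
  proof (intro equalityI subsetI)
    fix z assume "z \<in> sumset ?p (nat V) (?g ` {..m} \<union> {0})"
    then show "z \<in> {0..<?p}" using p by (auto simp: sumset_def)
  next
    fix z assume "z \<in> {0..<?p}"
    then have z: "int z < a (Suc m)" by auto
    \<comment> \<open>Since \<open>a 0 = 1\<close>, putting \<open>z\<close> chips on site 0
      represents \<open>z\<close>; this configuration is then reduced.\<close>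
    define c where "c i = (if i = 0 then int z else 0)" for i :: nat
    have "val c = int z" by (simp add: val_def c_def a_0 if_distrib[of "\<lambda>t. t * _"] sum.delta cong: if_cong)
    moreover obtain y where y: "reduced y" "a (Suc m) dvd val y - val c"
    proof -
      have "\<forall>i\<le>m. 0 \<le> c i" by (simp add: c_def)
      then show ?thesis using exists_reduced that by blast
    qed
    ultimately have "val y mod a (Suc m) = int z"
      using z by (metis mod_eq_dvd_iff mod_pos_pos_trivial of_nat_0_le_iff)
    moreover have "(\<Sum>i\<le>m. y i) \<le> int (nat V)" using max[OF y(1)] V by simp
    moreover have "\<forall>i\<le>m. 0 \<le> y i" using y(1) by (simp add: reduced_def)
    ultimately show "z \<in> sumset ?p (nat V) (?g ` {..m} \<union> {0})"
      unfolding mem by metis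
  qed
  moreover have "nat (val x mod a (Suc m)) \<notin> sumset ?p (nat V - 1) (?g ` {..m} \<union> {0})"
  proof
    assume "nat (val x mod a (Suc m)) \<in> sumset ?p (nat V - 1) (?g ` {..m} \<union> {0})"
    then obtain y where y: "\<forall>i\<le>m. 0 \<le> y i" "(\<Sum>i\<le>m. y i) \<le> int (nat V - 1)"
      "int (nat (val x mod a (Suc m))) = val y mod a (Suc m)"
      unfolding mem by blast
    have "val x mod a (Suc m) = val y mod a (Suc m)" using y(3) p by simp
    then have "a (Suc m) dvd val x - val y" by (simp add: mod_eq_dvd_iff)
    from reduced_minimal[OF x(1) y(1) this] show False using x(2) y(2) V by simp
  qed
  moreover have "nat (val x mod a (Suc m)) \<in> {0..<?p}" using p by simp
  ultimately show "is_basis_of_order ?p (?g ` {..m} \<union> {0}) (nat V)"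
    unfolding is_basis_of_order_def using sub p V by auto
qed

text \<open>With \<open>u m = 0\<close> the generator \<open>a m > 1\<close> would be a proper
  divisor of the prime \<open>a (Suc m)\<close>.\<close>

lemma sum_u_pos:
  assumes "prime (a (Suc m))"
  shows "1 \<le> (\<Sum>i\<le>m. u i)"
proof -
  have "u m \<noteq> 0"
  proof
    assume "u m = 0"
    then have "a (Suc m) = b m * a m" using a_Suc[of m] by simp
    then have "a m = 1 \<or> a m = a (Suc m)"
      using assms a_ge_1[of m] unfolding prime_int_iff
      by (metis dvd_triv_right le_SucI order_refl order_trans zero_le_one)
    then show False using a_less[of 0 m] a_less[of m "Suc m"] a_0 m_pos by auto
  qed
  then have "1 \<le> u m" using u_nonneg[of m] by simp
  also have "u m \<le> (\<Sum>i\<le>m. u i)" by (intro member_le_sum) (auto simp: u_nonneg)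
  finally show ?thesis .
qed

end

section \<open>Choice of the parameters\<close>

text \<open>The factors have a fixed sum, and moving them apart lowers their product in steps
  \<open>s + 2 * t + 2\<close>. The witness is the last \<open>t\<close> before the excess over
  \<open>Q\<close> first drops below \<open>\<theta>\<close>.\<close>

lemma unbalanced_factors:
  fixes N s Q \<theta> \<kappa> :: int
  assumes "0 \<le> s" "0 \<le> \<theta>" "\<theta> \<le> N" "0 < Q" "Q \<le> N * N" "N * N - \<kappa> * N \<le> Q"
    and small: "256 * (1 + \<kappa> + s) \<le> N"
  shows "\<exists>t\<ge>0. 16 * t \<le> N \<and> \<theta> \<le> (N - t) * (N + 1 + s + t) - Q \<and>
    (N - t) * (N + 1 + s + t) - Q < \<theta> + s + 2 * t + 2"
proof -
  define g where "g t = (N - t) * (N + 1 + s + t) - Q" for t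
  have g0: "g 0 \<ge> \<theta>"
  proof -
    have "N * s \<ge> 0" using assms by (intro mult_nonneg_nonneg) linarith+
    moreover have "g 0 = N * N + N + N * s - Q" by (simp add: g_def algebra_simps)
    ultimately show ?thesis using assms by linarith
  qed
  define P where "P n \<longleftrightarrow> g (int n) < \<theta>" for n :: nat
  have "P (nat N)" using assms by (simp add: P_def g_def)
  then have least: "P (LEAST n. P n)" "\<And>n. n < (LEAST n. P n) \<Longrightarrow> \<not> P n"
    by (auto intro: LeastI dest: not_less_Least)
  moreover have "\<not> P 0" using g0 by (simp add: P_def)
  ultimately obtain n where n: "(LEAST n. P n) = Suc n" by (metis not0_implies_Suc)
  define t where "t = int n"
  have lo: "\<theta> \<le> g t" using least(2)[of n] n by (simp add: P_def t_def)
  have "g (t + 1) < \<theta>" using least(1) n by (simp add: P_def t_def add.commute)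
  moreover have "g t - g (t + 1) = s + 2 * t + 2" by (simp add: g_def algebra_simps)
  ultimately have hi: "g t < \<theta> + s + 2 * t + 2" by simp
  have t0: "0 \<le> t" by (simp add: t_def)
  \<comment> \<open>The loss \<open>t * t + t * (1 + s)\<close> is at most
    \<open>N * (1 + \<kappa> + s)\<close>, hence at most \<open>N * N / 256\<close>, and 256 is the
    square of 16.\<close>
  have "16 * t \<le> N"
  proof (rule ccontr)
    assume "\<not> 16 * t \<le> N"
    then have "N * N < (16 * t) * (16 * t)" using assms by (intro mult_strict_mono) auto
    moreover have "0 \<le> t * (1 + s)" using t0 assms by simp
    moreover have "t * t + t * (1 + s) + g t = N * N + N * (1 + s) - Q"
      by (simp add: g_def algebra_simps)
    then have "t * t + t * (1 + s) \<le> N * (1 + \<kappa> + s)"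
      using lo assms by (simp add: algebra_simps)
    moreover have "N * (256 * (1 + \<kappa> + s)) \<le> N * N"
      using small assms by (intro mult_left_mono) linarith+
    ultimately show False by (simp add: algebra_simps)
  qed
  with lo hi t0 show ?thesis by (auto simp: g_def)
qed

text \<open>For \<open>i \<ge> 2\<close> the generator is \<open>\<lceil>p / N ^ (m + 1 - i)\<rceil>\<close>. Iterated ceilings compose, so
  consecutive generators differ from a ratio \<open>N\<close> only by a remainder below \<open>N\<close>.\<close>
definition ceil_chain_a :: "int \<Rightarrow> int \<Rightarrow> nat \<Rightarrow> int \<Rightarrow> nat \<Rightarrow> int" where
  "ceil_chain_a p N m b0 i = (if i = 0 then 1 else if i = 1 then b0 else - ((- p) div N ^ (Suc m - i)))"

definition ceil_chain_b :: "int \<Rightarrow> int \<Rightarrow> int \<Rightarrow> nat \<Rightarrow> int" where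
  "ceil_chain_b N b0 b1 i = (if i = 0 then b0 else if i = 1 then b1 else N)"

text \<open>From index 2 on these are base-\<open>N\<close> digits of \<open>- p\<close>; the sign
  turns rounding up into \<open>div\<close> and \<open>mod\<close>.\<close>

definition ceil_chain_u :: "int \<Rightarrow> int \<Rightarrow> nat \<Rightarrow> int \<Rightarrow> nat \<Rightarrow> int" where
  "ceil_chain_u p N m u1 i = (if i = 0 then 0 else if i = 1 then u1 else ((- p) div N ^ (m - i)) mod N)"

lemma toppling_chain_ceil:
  assumes "1 \<le> m" "3 \<le> N" "3 \<le> b0" "3 \<le> b1"
    and "u1 = b0 * b1 + (- p) div N ^ (m - 1)" "0 \<le> u1" "u1 < b1"
  shows "toppling_chain m (ceil_chain_a p N m b0) (ceil_chain_b N b0 b1) (ceil_chain_u p N m u1)"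
proof
  fix i assume i: "i \<le> m"
  show "ceil_chain_a p N m b0 (Suc i) =
      ceil_chain_b N b0 b1 i * ceil_chain_a p N m b0 i - ceil_chain_u p N m u1 i"
  proof (cases "i \<le> 1")
    case True
    then show ?thesis using assms
      by (cases "i = 0")
        (auto simp: ceil_chain_a_def ceil_chain_b_def ceil_chain_u_def le_Suc_eq algebra_simps)
  next
    case False
    have "Suc m - i = Suc (m - i)" using i by simp
    then have "(- p) div N ^ (Suc m - i) = (- p) div N ^ (m - i) div N"
      using assms by (simp add: zdiv_zmult2_eq power_Suc2 del: power_Suc)
    moreover have "(- p) div N ^ (m - i) =
        N * ((- p) div N ^ (m - i) div N) + (- p) div N ^ (m - i) mod N"
      by (rule mult_div_mod_eq[symmetric])
    ultimately have "- ((- p) div N ^ (m - i)) =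
        N * (- ((- p) div N ^ (Suc m - i))) - (- p) div N ^ (m - i) mod N"
      by (metis minus_diff_eq minus_mult_right diff_minus_eq_add minus_add_distrib uminus_add_conv_diff add.commute)
    then show ?thesis using False
      by (simp add: ceil_chain_a_def ceil_chain_b_def ceil_chain_u_def)
  qed
qed (use assms in \<open>auto simp: ceil_chain_a_def ceil_chain_b_def ceil_chain_u_def\<close>)

lemma sum_atMost_from_2:
  fixes f :: "nat \<Rightarrow> int"
  assumes "1 \<le> m"
  shows "(\<Sum>i\<le>m. f i) = f 0 + f 1 + (\<Sum>i=2..m. f i)"
proof -
  have "{..m} = insert 0 (insert 1 {2..m})" using assms by auto
  then show ?thesis by simp
qed

text \<open>Bernoulli's inequality for \<open>1 - 1 / N\<close>, cleared of denominators; it bounds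
  how far \<open>p\<close> lies below \<open>N ^ Suc m\<close>.\<close>

lemma power_diff_1_ge:
  fixes N :: int
  assumes "1 \<le> N"
  shows "N ^ Suc m - int (Suc m) * N ^ m \<le> (N - 1) ^ Suc m"
proof (induction m)
  case (Suc m)
  have "(N - 1) * (N ^ Suc m - int (Suc m) * N ^ m) \<le> (N - 1) * (N - 1) ^ Suc m"
    using Suc assms by (intro mult_left_mono) auto
  moreover have "0 \<le> int (Suc m) * N ^ m" using assms by simp
  ultimately show ?case by (simp add: algebra_simps)
qed simp

section \<open>Assembling the basis\<close>

lemma exists_basis_of_order:
  fixes p N :: int and m s :: nat
  assumes m: "1 \<le> m" and p: "prime p"
    and lower: "(N - 1) ^ Suc m \<le> p" and upper: "p < N ^ Suc m"
    and big: "1000 * (int m + 10) \<le> N" and s: "1000 * int s \<le> N"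
  shows "\<exists>A\<subseteq>{1..<nat p}. card A = Suc m \<and>
    is_basis_of_order (nat p) (A \<union> {0}) (Suc m * nat (N - 1) + s)"
proof -
  define D where "D = N ^ (m - 1)"
  \<comment> \<open>\<open>Q\<close> is \<open>a 2\<close> (the modulus if \<open>m = 1\<close>),
    which \<open>b 0 * b 1\<close> has to exceed by \<open>u1\<close>.\<close>
  define Q where "Q = - ((- p) div D)"
  define U where "U = (\<Sum>i=2..m. ((- p) div N ^ (m - i)) mod N)"
  define V where "V = int (Suc m) * (N - 1) + int s"
  have N_ge: "10000 \<le> N" using big by simp
  then have N0: "0 < N" by simp
  have pow: "N ^ Suc m = D * (N * N)" "N ^ m = D * N"
    using m unfolding D_def by (cases m; simp)+
  have D0: "0 < D" using N0 by (simp add: D_def)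
  have p0: "0 < p" using p by (simp add: prime_gt_0_int)
  have "D * ((- p) div D) + (- p) mod D = - p" by simp
  moreover have "0 \<le> (- p) mod D" "(- p) mod D < D" using D0 by simp_all
  moreover have "D * Q = - (D * ((- p) div D))" by (simp add: Q_def)
  ultimately have DQ: "p \<le> D * Q" "D * Q < p + D" by linarith+
  have Q_le: "Q \<le> N * N"
  proof -
    have "D * Q < D * (N * N + 1)" using DQ(2) upper pow by (simp add: algebra_simps)
    then show ?thesis using D0 by (simp add: mult_less_cancel_left)
  qed
  have Q_pos: "0 < Q"
  proof -
    have "D * 0 < D * Q" using DQ(1) p0 by simp
    then show ?thesis using D0 by (simp add: zero_less_mult_iff)
  qed
  have Q_ge: "N * N - (int m + 1) * N \<le> Q"
  proof -
    have "D * (N * N - (int m + 1) * N) \<le> D * Q"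
      using power_diff_1_ge[of N m] N0 lower DQ(1) pow by (simp add: algebra_simps)
    then show ?thesis using D0 by (simp add: mult_le_cancel_left)
  qed
  have U_nonneg: "0 \<le> U" unfolding U_def using N0 by (intro sum_nonneg) simp
  have U_le: "U \<le> int m * N"
  proof -
    have "U \<le> (\<Sum>i=2..m. N)"
      unfolding U_def using N0 by (intro sum_mono) (simp add: less_imp_le)
    also have "\<dots> \<le> int m * N" using N0 by (simp add: mult_right_mono)
    finally show ?thesis .
  qed
  have V_pos: "1 \<le> V"
  proof -
    have "1 * 1 \<le> int (Suc m) * (N - 1)" using big by (intro mult_mono) auto
    then show ?thesis by (simp add: V_def)
  qed
  have nat_V: "nat V = Suc m * nat (N - 1) + s"
    using N0 by (simp add: V_def nat_add_distrib nat_mult_distrib del: of_nat_Suc)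
  \<comment> \<open>Here \<open>b 0 + b 1 = 2 * N + 1 + s'\<close>, where \<open>s'\<close> is
    \<open>s\<close>, or \<open>s + 1\<close> to make up for the second chip missing from the second
    witness.\<close>
  have chain: "\<exists>A\<subseteq>{1..<nat p}. card A = Suc m \<and> is_basis_of_order (nat p) (A \<union> {0}) (nat V)"
    if t: "0 \<le> t" "16 * t \<le> N"
      and u1: "u1 = (N - t) * (N + 1 + s' + t) - Q" "0 \<le> u1" "u1 < N - t"
      and s': "0 \<le> s'"
      and cases: "s' = int s \<and> u1 + U \<le> N
        \<or> s' = int s + 1 \<and> 2 \<le> m \<and> 1 \<le> u1 \<and> N + 1 + s' + t < u1 + U"
    for t u1 s'
  proof -
    define b0 where "b0 = N + 1 + s' + t"
    define b1 where "b1 = N - t"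
    define a where "a = ceil_chain_a p N m b0"
    define b where "b = ceil_chain_b N b0 b1"
    define u where "u = ceil_chain_u p N m u1"
    have b1_ge: "15 * N \<le> 16 * b1" using t by (simp add: b1_def)
    have b0_ge: "N + 1 \<le> b0" using t s' by (simp add: b0_def)
    interpret toppling_chain m a b u
      unfolding a_def b_def u_def
      using m big b1_ge b0_ge u1
      by (intro toppling_chain_ceil) (auto simp: b0_def b1_def Q_def D_def mult.commute)
    have ap: "a (Suc m) = p" using m by (simp add: a_def ceil_chain_a_def)
    have "(\<Sum>i=2..m. u i) = U"
      unfolding U_def by (rule sum.cong) (auto simp: u_def ceil_chain_u_def)
    then have sum_u: "(\<Sum>i\<le>m. u i) = u1 + U"
      using m by (simp add: sum_atMost_from_2 u_def ceil_chain_u_def)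
    have "(\<Sum>i=2..m. b i - 1) = (\<Sum>i=2..m. N - 1)"
      by (rule sum.cong) (auto simp: b_def ceil_chain_b_def)
    then have sum_b: "(\<Sum>i\<le>m. b i - 1) = 2 * N - 1 + s' + (int m - 1) * (N - 1)"
      using m by (simp add: sum_atMost_from_2 b_def ceil_chain_b_def b0_def b1_def of_nat_diff)
    have b01: "b 0 = b0" "b 1 = b1" and u_1: "u 1 = u1"
      by (simp_all add: b_def u_def ceil_chain_b_def ceil_chain_u_def)
    have "\<exists>x. reduced x \<and> (\<Sum>i\<le>m. x i) = V \<and> (\<forall>y. reduced y \<longrightarrow> (\<Sum>i\<le>m. y i) \<le> V)"
      using cases
    proof
      assume c: "s' = int s \<and> u1 + U \<le> N"
      then have V: "V = (\<Sum>i\<le>m. b i - 1) - 1"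
        by (simp add: sum_b V_def algebra_simps)
      have "(\<Sum>i\<le>m. u i) \<le> b 0" using c b0_ge by (simp add: sum_u b01)
      moreover have "1 \<le> (\<Sum>i\<le>m. u i)" using sum_u_pos p ap by simp
      ultimately show ?thesis
        using reduced_witness_1 reduced_sum_le_1 unfolding V by blast
    next
      assume c: "s' = int s + 1 \<and> 2 \<le> m \<and> 1 \<le> u1 \<and> N + 1 + s' + t < u1 + U"
      then have V: "V = (\<Sum>i\<le>m. b i - 1) - 2"
        by (simp add: sum_b V_def algebra_simps)
      have "b 0 < (\<Sum>i\<le>m. u i)" using c by (simp add: sum_u b01 b0_def)
      moreover have "1 \<le> u 1" using c unfolding u_1 by simp
      moreover have "u 1 \<le> b 0" using u1 t b0_ge unfolding u_1 b01 by linarith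
      moreover have "2 * (\<Sum>i\<le>m. u i) \<le> b 0 * b 1"
      proof -
        have "2 * (u1 + U) \<le> N * (2 * int m + 2)"
          using u1 t U_le by (simp add: algebra_simps)
        also have "\<dots> \<le> b0 * b1"
          using N0 b0_ge b1_ge big by (intro mult_mono) auto
        finally show ?thesis unfolding sum_u b01 .
      qed
      ultimately show ?thesis
        using reduced_witness_2 reduced_sum_le_2 c unfolding V by blast
    qed
    then obtain x where "reduced x" "(\<Sum>i\<le>m. x i) = V" "\<And>y. reduced y \<Longrightarrow> (\<Sum>i\<le>m. y i) \<le> V"
      by blast
    from basis_of_order[OF this(1,2) V_pos this(3)] show ?thesis
      unfolding ap by blast
  qed
  show ?thesis
  proof (cases "2 * U \<le> N")
    case True
    have "256 * (1 + (int m + 1) + int s) \<le> N" using big s N0 by simp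
    then obtain t u1 where t: "0 \<le> t" "16 * t \<le> N"
      and u1: "u1 = (N - t) * (N + 1 + int s + t) - Q" "0 \<le> u1" "u1 < int s + 2 * t + 2"
      using unbalanced_factors[of "int s" 0 N Q "int m + 1"] N0 Q_pos Q_le Q_ge by auto
    show ?thesis
      unfolding nat_V[symmetric]
    proof (rule chain[OF t u1(1,2)])
      show "u1 < N - t" using t u1(3) s N_ge by linarith
      have "u1 + U \<le> N" using t(2) u1(3) s N_ge True by linarith
      then show "int s = int s \<and> u1 + U \<le> N
        \<or> int s = int s + 1 \<and> 2 \<le> m \<and> 1 \<le> u1 \<and> N + 1 + int s + t < u1 + U"
        by simp
    qed simp
  next
    case False
    \<comment> \<open>For \<open>m = 1\<close> the sum \<open>U\<close> is empty.\<close>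
    then have m2: "2 \<le> m" using N0 by (cases "m = 1") (use m in \<open>auto simp: U_def\<close>)
    \<comment> \<open>Since \<open>U > N / 2\<close>, the total then exceeds
      \<open>5 * N / 4\<close>, whereas \<open>b 0\<close> is about \<open>17 * N / 16\<close> at
      most; an overshoot of about \<open>N / 8\<close> still keeps \<open>u1\<close> below
      \<open>b 1 \<ge> 15 * N / 16\<close>.\<close>
    define \<theta> where "\<theta> = N - N div 4"
    have \<theta>: "3 * N \<le> 4 * \<theta>" "4 * \<theta> \<le> 3 * N + 3" by (auto simp: \<theta>_def)
    then have "0 \<le> \<theta>" "\<theta> \<le> N" using N_ge by linarith+
    moreover have "256 * (1 + (int m + 1) + (int s + 1)) \<le> N" using big s N0 by simp
    ultimately obtain t u1 where t: "0 \<le> t" "16 * t \<le> N"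
      and u1: "u1 = (N - t) * (N + 1 + (int s + 1) + t) - Q" "\<theta> \<le> u1"
        "u1 < \<theta> + (int s + 1) + 2 * t + 2"
      using unbalanced_factors[of "int s + 1" \<theta> N Q "int m + 1"] Q_pos Q_le Q_ge by auto
    show ?thesis
      unfolding nat_V[symmetric]
    proof (rule chain[OF t u1(1)])
      show "0 \<le> u1" using u1(2) \<theta> N_ge by linarith
      show "u1 < N - t" using t u1(3) s \<theta>(2) N_ge by linarith
      have "N + 1 + (int s + 1) + t < u1 + U"
        using t(2) u1(2) s \<theta>(1) N_ge False by linarith
      moreover have "1 \<le> u1" using u1(2) \<theta>(1) N_ge by linarith
      ultimately show "int s + 1 = int s \<and> u1 + U \<le> N
        \<or> int s + 1 = int s + 1 \<and> 2 \<le> m \<and> 1 \<le> u1 \<and> N + 1 + (int s + 1) + t < u1 + U"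
        using m2 by simp
    qed simp
  qed
qed

theorem theorem4p4:
  shows "\<exists>c::real. c > 0 \<and>
    (\<forall>k::nat. k \<ge> 2 \<longrightarrow>
      (\<exists>P::nat. \<forall>p::nat. prime p \<and> p \<ge> P \<longrightarrow>
        (\<forall>s::nat. real s < c * real (nat \<lfloor>root k (real p)\<rfloor>) \<longrightarrow>
          (\<exists>A::nat set. A \<subseteq> {1..<p} \<and> card A = k \<and>
             is_basis_of_order p (A \<union> {0}) (k * nat \<lfloor>root k (real p)\<rfloor> + s)))))"
proof (intro exI[of _ "1/1000"] conjI allI impI)
  fix k :: nat
  assume "2 \<le> k"
  then obtain m where k: "k = Suc m" and m: "1 \<le> m" by (cases k) auto
  show "\<exists>P. \<forall>p. prime p \<and> P \<le> p \<longrightarrow>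
      (\<forall>s. real s < 1/1000 * real (nat \<lfloor>root k (real p)\<rfloor>) \<longrightarrow>
        (\<exists>A\<subseteq>{1..<p}. card A = k \<and>
          is_basis_of_order p (A \<union> {0}) (k * nat \<lfloor>root k (real p)\<rfloor> + s)))"
  \<comment> \<open>Together with \<open>p < (n + 1) ^ k\<close> this threshold makes
    \<open>N = n + 1\<close> large compared with \<open>m\<close>.\<close>
  proof (intro exI[of _ "(1000 * (m + 10)) ^ k"] allI impI)
    fix p s :: nat
    assume p: "prime p \<and> (1000 * (m + 10)) ^ k \<le> p"
      and s: "real s < 1/1000 * real (nat \<lfloor>root k (real p)\<rfloor>)"
    define n where "n = nat \<lfloor>root k (real p)\<rfloor>"
    have r0: "0 \<le> root k (real p)" by (simp add: k)
    have n: "real n \<le> root k (real p)" "root k (real p) < real n + 1"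
      using r0 by (simp_all add: n_def)
    have root_pow: "root k (real p) ^ k = real p" by (simp add: k real_root_pow_pos2 del: power_Suc)
    have "real n ^ k \<le> real p"
      using power_mono[OF n(1), of k] root_pow by simp
    then have lo: "n ^ k \<le> p" by (simp flip: of_nat_power)
    have "real p < (real n + 1) ^ k"
      using power_strict_mono[OF n(2) r0, of k] root_pow k by simp
    then have "real p < real ((n + 1) ^ k)" by (simp add: add.commute)
    then have hi: "p < (n + 1) ^ k" by (simp only: of_nat_less_iff)
    have "(1000 * (m + 10)) ^ k < (n + 1) ^ k" using p hi by linarith
    then have big: "1000 * (m + 10) < n + 1" by (rule power_less_imp_less_base) simp
    have "1000 * s \<le> n" using s by (simp add: n_def[symmetric])
    have "\<exists>A\<subseteq>{1..<nat (int p)}. card A = Suc m \<and>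
        is_basis_of_order (nat (int p)) (A \<union> {0}) (Suc m * nat (int (n + 1) - 1) + s)"
    proof (rule exists_basis_of_order[OF m])
      show "prime (int p)" using p by simp
      have "int (n ^ k) \<le> int p" using lo by (simp only: of_nat_le_iff)
      then show "(int (n + 1) - 1) ^ Suc m \<le> int p" by (simp add: k)
      have "int p < int ((n + 1) ^ k)" using hi by (simp only: of_nat_less_iff)
      then show "int p < int (n + 1) ^ Suc m" by (simp only: k of_nat_power)
    qed (use big \<open>1000 * s \<le> n\<close> in auto)
    then show "\<exists>A\<subseteq>{1..<p}. card A = k \<and>
        is_basis_of_order p (A \<union> {0}) (k * nat \<lfloor>root k (real p)\<rfloor> + s)"
      by (simp add: k n_def)
  qed
qed simp

end
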